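(* Let $(x_n)_{n\in\mathbb N}$ be the sequence in $\mathbb R^2$ constructed in the context, and let $S=\{y\in\mathbb R^2 : \|y\|=1\}$. Set $A := \{x_{2n} : n\in\mathbb N\}\cup S$, $B := \{x_{2n+1} : n\in\mathbb N\}\cup S$, and $b_{-1}:=x_0$. Then $A$ and $B$ are nonempty compact subsets of $\mathbb R^2$. The sequences of alternating projections $(a_n)_{n\in\mathbb N}$ and $(b_n)_{n\in\mathbb N}$ starting at $b_{-1}$, i.e. $a_n\in P_A(b_{n-1})$ and $b_n\in P_B(a_n)$ for all $n\in\mathbb N$, satisfy, for every $n\in\mathbb N$, $$P_A(b_{n-1})=\{a_n\}=\{x_{2n}\}\quad\text{and}\quad P_B(a_n)=\{b_n\}=\{x_{2n+1}\}.$$ Moreover, $a_n-b_{n-1}\to 0$, $b_n-a_n\to 0$, and $S$ is the set of cluster points of $(a_n)_{n\in\mathbb N}$ and also the set of cluster points of $(b_n)_{n\in\mathbb N}$.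
   Context: $\mathbb N=\{0,1,2,\dots\}$ and $\mathbb R_+=[0,+\infty[$. $\mathbb R^2$ carries the Euclidean norm $\|\cdot\|$. For a subset $C$ of $\mathbb R^2$ and a point $y\in\mathbb R^2$, the projection of $y$ onto $C$ is the (set-valued) $P_C y := \{c\in C : \|y-c\| = \inf_{z\in C}\|y-z\|\}$. Construction of $(x_n)_{n\in\mathbb N}$. Define $\rho:\mathbb R_+\to\mathbb R_+$ by $\rho(t)=1+\exp(-t)$; define $\varepsilon:\mathbb R_+\to\left]0,+\infty\right[$ by $\varepsilon(t)=\frac{\rho(t)-\rho(t+2\pi)}{2}$; and define the curve $x:\mathbb R_+\to\mathbb R^2$ by $x(\alpha)=\rho(\alpha)\cdot(\cos\alpha,\sin\alpha)$. For every $\alpha\in\mathbb R_+$ there exists a unique $\beta>\alpha$ such that $\|x(\beta)-x(\alpha)\|=\varepsilon(\alpha)$. Set $\alpha_0:=0$ and, recursively, let $\alpha_{n+1}$ be the unique real number $\beta>\alpha_n$ such that $\|x(\beta)-x(\alpha_n)\|=\varepsilon(\alpha_n)$. Finally put $x_n:=x(\alpha_n)$ for every $n\in\mathbb N$ (so $x_0=(2,0)$). *)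

theory Defs
  imports "HOL-Analysis.Analysis"
begin

definition proj :: "'a::real_normed_vector set \<Rightarrow> 'a \<Rightarrow> 'a set" where
  "proj C y = {c \<in> C. norm (y - c) = (INF z\<in>C. norm (y - z))}"

definition cluster_points :: "(nat \<Rightarrow> 'a::topological_space) \<Rightarrow> 'a set" where
  "cluster_points s = {l. \<exists>r :: nat \<Rightarrow> nat. strict_mono r \<and> (s \<circ> r) \<longlonglongrightarrow> l}"

(* preceding y b n stands for b_(n-1), with the convention b_(-1) = y. *)
definition preceding :: "'a \<Rightarrow> (nat \<Rightarrow> 'a) \<Rightarrow> nat \<Rightarrow> 'a" where
  "preceding y b n = (case n of 0 \<Rightarrow> y | Suc m \<Rightarrow> b m)"

definition alternating_projections ::
  "'a::real_normed_vector set \<Rightarrow> 'a set \<Rightarrow> 'a \<Rightarrow> (nat \<Rightarrow> 'a) \<Rightarrow> (nat \<Rightarrow> 'a) \<Rightarrow> bool" where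
  "alternating_projections A B y a b \<longleftrightarrow>
     (\<forall>n. a n \<in> proj A (preceding y b n) \<and> b n \<in> proj B (a n))"

(* The mathematical domain of rho, eps and curve is the half-line [0, \<infinity>); the formulas
   are extended to all reals, but the construction below only uses arguments t \<ge> 0. *)
definition rho :: "real \<Rightarrow> real" where
  "rho t = 1 + exp (- t)"

definition eps :: "real \<Rightarrow> real" where
  "eps t = (rho t - rho (t + 2 * pi)) / 2"

definition curve :: "real \<Rightarrow> real ^ 2" where
  "curve \<alpha> = rho \<alpha> *\<^sub>R vector [cos \<alpha>, sin \<alpha>]"

(* For every \<alpha> \<ge> 0 the description below is satisfied by exactly one \<beta>, so THE
   denotes it at every step of the recursion. *)
primrec angle :: "nat \<Rightarrow> real" where
  "angle 0 = 0"
| "angle (Suc n) = (THE \<beta>. \<beta> > angle n \<and> norm (curve \<beta> - curve (angle n)) = eps (angle n))"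

definition spiral :: "nat \<Rightarrow> real ^ 2" where
  "spiral n = curve (angle n)"

definition unit_circle :: "(real ^ 2) set" where
  "unit_circle = {y. norm y = 1}"

definition even_set :: "(real ^ 2) set" where
  "even_set = {spiral (2 * n) | n. True} \<union> unit_circle"

definition odd_set :: "(real ^ 2) set" where
  "odd_set = {spiral (2 * n + 1) | n. True} \<union> unit_circle"

end

theory Submission
  imports Defs
begin

text \<open>
  The proof rests on one observation: from a point of the spiral, the later point at distance
  \<open>eps\<close> separates the nearer later points from the farther ones.  For angular gaps of at most
  \<open>ln 2\<close> the chord grows strictly with the gap (lemma \<open>chord_strict_mono\<close>), and for gaps of at
  least \<open>ln 2\<close> the radius alone has already dropped by half of its excess over 1, which is more
  than \<open>eps\<close> (lemma \<open>eps_less_chord\<close>).  Hence the successor is unique, and every point beyond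
  it is farther than \<open>eps\<close> (lemma \<open>eps_less_chord_beyond\<close>).

  Both halves of the projection claim follow from this.  Fix a spiral point \<open>spiral m\<close> and compare
  the distance \<open>eps (angle m)\<close> to its successor with the distance to any competitor.  A spiral
  point after the successor is farther by the observation.  A spiral point \<open>spiral k\<close> with
  \<open>k < m\<close> has \<open>spiral m\<close> at or beyond its own successor, so it is at distance at least
  \<open>eps (angle k)\<close>, which exceeds \<open>eps (angle m)\<close> because \<open>eps\<close> decreases.  The unit circle is at
  distance \<open>exp (- angle m)\<close>, more than twice \<open>eps (angle m)\<close>.

  The angles cannot accumulate at a finite value, since there \<open>eps\<close> would stay away from 0 while
  consecutive points merge.  So they tend to infinity, the steps \<open>eps (angle n)\<close> tend to 0, and
  so do the angular increments.  A real sequence that tends to infinity with vanishing increments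
  comes arbitrarily close to every residue modulo \<open>2 * pi\<close>; as the radii tend to 1, all points of
  the circle are cluster points, and only these.
\<close>

section \<open>Projections, compactness and subsequences\<close>

lemma proj_eq_singletonI:
  fixes y c :: "'a::real_normed_vector"
  assumes "c \<in> C" and closest: "\<And>z. z \<in> C \<Longrightarrow> z \<noteq> c \<Longrightarrow> norm (y - c) < norm (y - z)"
  shows "proj C y = {c}"
proof -
  have "norm (y - c) \<le> norm (y - z)" if "z \<in> C" for z
    using closest[OF that] by (cases "z = c") auto
  with \<open>c \<in> C\<close> have "(INF z\<in>C. norm (y - z)) = norm (y - c)"
    by (intro cInf_eq_minimum) auto
  with assms show ?thesis
    by (force simp: proj_def)
qed

text \<open>
  A finite subcover of \<open>S\<close> contains a uniform neighbourhood of \<open>S\<close>, which leaves only finitely many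
  terms of the sequence uncovered.
\<close>
lemma compact_range_Un:
  fixes y z :: "nat \<Rightarrow> 'a::heine_borel"
  assumes "compact S" "\<And>n. z n \<in> S" and lim: "(\<lambda>n. dist (y n) (z n)) \<longlonglongrightarrow> 0"
  shows "compact (range y \<union> S)"
proof (rule compactI)
  fix C assume C: "\<forall>t\<in>C. open t" "range y \<union> S \<subseteq> \<Union>C"
  then obtain D where D: "D \<subseteq> C" "finite D" "S \<subseteq> \<Union>D"
    using compactE[OF \<open>compact S\<close>, of C] by (metis le_sup_iff)
  have "open (\<Union>D)" using C D by blast
  then obtain e where e: "e > 0" "(\<Union>x\<in>S. ball x e) \<subseteq> \<Union>D"
    using compact_subset_open_imp_ball_epsilon_subset[OF \<open>compact S\<close> _ D(3)] by blast
  obtain N where N: "\<And>n. n \<ge> N \<Longrightarrow> dist (y n) (z n) < e"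
    using lim \<open>e > 0\<close> unfolding lim_sequentially by auto
  have tail: "y n \<in> \<Union>D" if "n \<ge> N" for n
  proof -
    have "y n \<in> ball (z n) e" using N[OF that] by (simp add: dist_commute)
    with e(2) assms(2)[of n] show ?thesis by blast
  qed
  obtain D' where D': "D' \<subseteq> C" "finite D'" "y ` {..<N} \<subseteq> \<Union>D'"
    using compactE[of "y ` {..<N}" C] C by (force intro: finite_imp_compact)
  have "range y \<union> S \<subseteq> \<Union>(D \<union> D')"
  proof
    fix p assume "p \<in> range y \<union> S"
    then consider "p \<in> S" | n where "p = y n" by auto
    then show "p \<in> \<Union>(D \<union> D')"
    proof cases
      case 1
      then show ?thesis using D(3) by auto
    next
      case (2 n)
      then show ?thesis using tail[of n] D'(3) by (cases "n \<ge> N") (auto simp: image_subset_iff)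
    qed
  qed
  with D D' show "\<exists>C'\<subseteq>C. finite C' \<and> range y \<union> S \<subseteq> \<Union>C'"
    by (intro exI[of _ "D \<union> D'"]) auto
qed

text \<open>
  The subsequence takes, for each \<open>k\<close>, the first time the sequence reaches \<open>\<theta> + T * k\<close>.  It
  overshoots by at most the last increment.  As increments stay below \<open>T\<close>, the next target
  \<open>\<theta> + T * (k + 1)\<close> is not reached at the same time, so the indices strictly increase.
\<close>
lemma vanishing_steps_imp_subsequence_mod:
  fixes s :: "nat \<Rightarrow> real"
  assumes top: "filterlim s at_top sequentially"
    and steps: "(\<lambda>n. s (Suc n) - s n) \<longlonglongrightarrow> 0"
    and short: "\<And>n. s (Suc n) - s n < T"
    and start: "s 0 < \<theta>" and "T > 0"
  obtains r :: "nat \<Rightarrow> nat" where "strict_mono r" "(\<lambda>k. s (r k) - (\<theta> + T * k)) \<longlonglongrightarrow> 0"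
proof -
  define r where "r k = (LEAST n. \<theta> + T * real k \<le> s n)" for k
  have "\<exists>n. c \<le> s n" for c
    using top unfolding filterlim_at_top by (meson eventually_happens' sequentially_bot)
  then have reach: "\<theta> + T * real k \<le> s (r k)" for k
    unfolding r_def by (rule LeastI_ex)
  have before: "s m < \<theta> + T * real k" if "m < r k" for m k
    using not_less_Least[OF that[unfolded r_def]] by simp
  have pos: "r k > 0" for k
  proof (rule ccontr)
    assume "\<not> r k > 0"
    moreover have "T * real k \<ge> 0" using \<open>T > 0\<close> by simp
    ultimately show False using reach[of k] start by simp
  qed
  have overshoot: "s (r k) - (\<theta> + T * real k) \<le> s (r k) - s (r k - 1)" for k
    using before[of "r k - 1" k] pos[of k] by simp
  have "r k < r (Suc k)" for k
  proof (rule ccontr)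
    assume "\<not> r k < r (Suc k)"
    then consider "r (Suc k) = r k" | "r (Suc k) < r k" by linarith
    then have "s (r (Suc k)) < \<theta> + T * real (Suc k)"
    proof cases
      case 1
      have "s (r k) - s (r k - 1) < T"
        using short[of "r k - 1"] pos[of k] by simp
      with 1 overshoot[of k] show ?thesis by (simp add: algebra_simps)
    next
      case 2
      with before[OF 2] \<open>T > 0\<close> show ?thesis by (simp add: algebra_simps)
    qed
    with reach[of "Suc k"] show False by simp
  qed
  then have mono: "strict_mono r" by (simp add: strict_mono_Suc_iff)
  have "filterlim (\<lambda>k. r k - 1) sequentially sequentially"
    by (intro filterlim_compose[OF filterlim_minus_const_nat_at_top] filterlim_subseq mono)
  from filterlim_compose[OF steps this]
  have last: "(\<lambda>k. s (r k) - s (r k - 1)) \<longlonglongrightarrow> 0"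
    using pos by simp
  have "(\<lambda>k. s (r k) - (\<theta> + T * k)) \<longlonglongrightarrow> 0"
    by (rule tendsto_sandwich[OF _ _ tendsto_const last])
       (use reach overshoot in \<open>auto intro!: always_eventually\<close>)
  with mono that show thesis by blast
qed

section \<open>Chords of the spiral\<close>

lemma norm_vector_2: "norm (vector [a, b] :: real ^ 2) = sqrt (a\<^sup>2 + b\<^sup>2)"
  by (simp add: norm_eq_sqrt_inner inner_vec_def sum_2 power2_eq_square)

lemma curve_eq: "curve t = vector [rho t * cos t, rho t * sin t]"
  by (simp add: curve_def vec_eq_iff forall_2)

lemma continuous_curve: "isCont curve t"
  unfolding isCont_def
proof (rule vec_tendstoI)
  show "(\<lambda>t. curve t $ i) \<midarrow>t\<rightarrow> curve t $ i" for i
    using exhaust_2[of i] unfolding curve_eq rho_def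
      by (elim disjE) (simp_all, (intro tendsto_intros)+)
qed

lemma rho_gt_1: "rho t > 1"
  by (simp add: rho_def)

lemma norm_curve: "norm (curve t) = rho t"
  using rho_gt_1[of t] by (simp add: curve_def norm_vector_2)

lemma eps_eq: "eps t = exp (- t) * ((1 - exp (- (2 * pi))) / 2)"
  by (simp add: eps_def rho_def algebra_simps exp_add[symmetric])

lemma eps_pos: "eps t > 0"
  by (simp add: eps_eq)

lemma eps_less_half: "eps t < exp (- t) / 2"
  by (simp add: eps_eq)

lemma eps_strict_antimono: "s < t \<Longrightarrow> eps t < eps s"
  by (simp add: eps_eq)

lemma continuous_eps: "isCont eps t"
  unfolding eps_eq by (intro continuous_intros)

lemma norm_chord_sq:
  "(norm (curve b - curve a))\<^sup>2 = (rho a - rho b)\<^sup>2 + 2 * rho a * (rho b * (1 - cos (b - a)))"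
proof -
  have "curve b - curve a
      = vector [rho b * cos b - rho a * cos a, rho b * sin b - rho a * sin a]"
    by (simp add: curve_eq vec_eq_iff forall_2)
  then have "(norm (curve b - curve a))\<^sup>2
      = (rho b * cos b - rho a * cos a)\<^sup>2 + (rho b * sin b - rho a * sin a)\<^sup>2"
    by (simp add: norm_vector_2)
  also have "\<dots> = (rho b)\<^sup>2 * ((cos b)\<^sup>2 + (sin b)\<^sup>2) + (rho a)\<^sup>2 * ((cos a)\<^sup>2 + (sin a)\<^sup>2)
      - 2 * rho a * rho b * cos (b - a)"
    unfolding cos_diff by algebra
  also have "\<dots> = (rho a - rho b)\<^sup>2 + 2 * rho a * (rho b * (1 - cos (b - a)))"
    by (simp add: power2_eq_square algebra_simps)
  finally show ?thesis .
qed

text \<open>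
  In the formula for the squared chord the factor \<open>rho b\<close> decreases while \<open>1 - cos (b - a)\<close>
  increases.  Only the part \<open>exp (- b)\<close> of \<open>rho b\<close> varies, and its product with the cosine term
  still increases because the derivative \<open>exp (- d) * (sin d + cos d - 1)\<close> is nonnegative on
  the first quadrant.
\<close>
lemma exp_minus_times_one_minus_cos_mono:
  fixes d e :: real
  assumes "0 \<le> d" "d \<le> e" "e \<le> pi / 2"
  shows "exp (- d) * (1 - cos d) \<le> exp (- e) * (1 - cos e)"
proof (rule DERIV_nonneg_imp_nondecreasing[OF \<open>d \<le> e\<close>])
  fix t assume "d \<le> t" "t \<le> e"
  with assms have t: "0 \<le> t" "t \<le> pi / 2" by auto
  then have s: "sin t \<ge> 0" "cos t \<ge> 0"
    by (auto intro!: sin_ge_zero cos_ge_zero)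
  have "(sin t + cos t)\<^sup>2 = 1 + 2 * (sin t * cos t)"
    using sin_cos_squared_add[of t] by (simp add: power2_sum)
  then have "1\<^sup>2 \<le> (sin t + cos t)\<^sup>2" using s by simp
  then have "sin t + cos t \<ge> 1"
    by (rule power2_le_imp_le) (use s in auto)
  moreover have "((\<lambda>t. exp (- t) * (1 - cos t)) has_real_derivative
      exp (- t) * (sin t + cos t - 1)) (at t)"
    by (auto intro!: derivative_eq_intros simp: algebra_simps)
  ultimately show "\<exists>y. ((\<lambda>t. exp (- t) * (1 - cos t)) has_real_derivative y) (at t) \<and> 0 \<le> y"
    by (intro exI conjI) auto
qed

lemma ln_2_le_pi_half: "ln 2 \<le> pi / 2"
  using ln_2_less_1 pi_gt3 by linarith

lemma chord_strict_mono:
  assumes "a \<le> b" "b < c" "c \<le> a + ln 2"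
  shows "norm (curve b - curve a) < norm (curve c - curve a)"
proof (rule power2_less_imp_less)
  have d: "0 \<le> b - a" "b - a < c - a" "c - a \<le> pi / 2"
    using assms ln_2_le_pi_half by auto
  have radial: "(rho a - rho b)\<^sup>2 \<le> (rho a - rho c)\<^sup>2"
    using assms by (intro power_mono) (auto simp: rho_def)
  have "exp (- (b - a)) * (1 - cos (b - a)) \<le> exp (- (c - a)) * (1 - cos (c - a))"
    using d by (intro exp_minus_times_one_minus_cos_mono) auto
  then have "exp (- a) * (exp (- (b - a)) * (1 - cos (b - a)))
      \<le> exp (- a) * (exp (- (c - a)) * (1 - cos (c - a)))"
    by (rule mult_left_mono) simp
  then have "exp (- b) * (1 - cos (b - a)) \<le> exp (- c) * (1 - cos (c - a))"
    unfolding mult.assoc[symmetric] exp_add[symmetric] by simp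
  moreover have "cos (c - a) < cos (b - a)"
    using d pi_gt_zero by (intro cos_monotone_0_pi) auto
  ultimately have "rho b * (1 - cos (b - a)) < rho c * (1 - cos (c - a))"
    by (simp add: rho_def algebra_simps)
  then have "2 * rho a * (rho b * (1 - cos (b - a))) < 2 * rho a * (rho c * (1 - cos (c - a)))"
    using rho_gt_1[of a] by simp
  with radial show "(norm (curve b - curve a))\<^sup>2 < (norm (curve c - curve a))\<^sup>2"
    by (simp add: norm_chord_sq)
qed simp

text \<open>
  After a gap of \<open>ln 2\<close> the excess of the radius over 1 has halved, so the difference of the norms
  alone exceeds \<open>eps\<close>; in particular later turns of the spiral stay away.
\<close>
lemma eps_less_chord:
  assumes "a + ln 2 \<le> b"
  shows "eps a < norm (curve b - curve a)"
proof -
  have "exp (- b) \<le> exp (- a - ln 2)" using assms by simp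
  also have "\<dots> = exp (- a) / 2" by (simp add: exp_diff)
  finally have "exp (- a) / 2 \<le> rho a - rho b" by (simp add: rho_def)
  also have "\<dots> \<le> norm (curve b - curve a)"
    using norm_triangle_ineq2[of "curve a" "curve b"] by (simp add: norm_curve norm_minus_commute)
  finally show ?thesis using eps_less_half[of a] by linarith
qed

lemma eps_less_chord_beyond:
  assumes "a < b" "norm (curve b - curve a) = eps a" "b < c"
  shows "eps a < norm (curve c - curve a)"
proof (cases "a + ln 2 \<le> c")
  case True
  then show ?thesis by (rule eps_less_chord)
next
  case False
  then show ?thesis using chord_strict_mono[of a b c] assms by simp
qed

lemma ex1_successor: "\<exists>!b. b > a \<and> norm (curve b - curve a) = eps a"
proof -
  have "\<exists>b. a \<le> b \<and> b \<le> a + ln 2 \<and> norm (curve b - curve a) = eps a"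
    using eps_pos[of a] eps_less_chord[of a "a + ln 2"]
    by (intro IVT[where f = "\<lambda>b. norm (curve b - curve a)"])
       (auto intro!: isCont_norm isCont_diff continuous_curve)
  then obtain b where "a \<le> b" "norm (curve b - curve a) = eps a" by blast
  moreover have "a \<noteq> b" using calculation eps_pos[of a] by auto
  ultimately have b: "b > a" "norm (curve b - curve a) = eps a" by auto
  show ?thesis
  proof (rule ex1I[of _ b])
    fix c assume "c > a \<and> norm (curve c - curve a) = eps a"
    with b show "c = b"
      using eps_less_chord_beyond[of a b c] eps_less_chord_beyond[of a c b] by linarith
  qed (use b in simp)
qed

section \<open>The sequence of angles\<close>

lemma angle_Suc:
  "angle (Suc n) > angle n" "norm (curve (angle (Suc n)) - curve (angle n)) = eps (angle n)"
  using theI'[OF ex1_successor[of "angle n"]] by auto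

declare angle.simps(2) [simp del]

lemma strict_mono_angle: "strict_mono angle"
  by (simp add: strict_mono_Suc_iff angle_Suc)

lemma angle_step_less_ln_2: "angle (Suc n) - angle n < ln 2"
  using eps_less_chord[of "angle n" "angle (Suc n)"] angle_Suc[of n] by fastforce

text \<open>
  At a finite limit of the angles the chords would tend to 0 by continuity of the curve, but
  they tend to the value of \<open>eps\<close> there, which is positive.
\<close>
lemma angle_at_top: "filterlim angle at_top sequentially"
proof -
  have "\<exists>n. c \<le> angle n" for c
  proof (rule ccontr)
    assume "\<not> (\<exists>n. c \<le> angle n)"
    then have "\<forall>n. angle n \<le> c" by (meson linear)
    then obtain L where L: "angle \<longlonglongrightarrow> L"
      using incseq_convergent[of angle c] strict_mono_mono[OF strict_mono_angle] by blast
    have c: "(\<lambda>n. curve (angle n)) \<longlonglongrightarrow> curve L"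
      by (rule isCont_tendsto_compose[OF continuous_curve L])
    have "(\<lambda>n. norm (curve (angle (Suc n)) - curve (angle n))) \<longlonglongrightarrow> norm (curve L - curve L)"
      by (intro tendsto_intros c LIMSEQ_Suc[OF c])
    then have "(\<lambda>n. eps (angle n)) \<longlonglongrightarrow> 0" by (simp add: angle_Suc)
    moreover have "(\<lambda>n. eps (angle n)) \<longlonglongrightarrow> eps L"
      by (rule isCont_tendsto_compose[OF continuous_eps L])
    ultimately show False using LIMSEQ_unique eps_pos[of L] by force
  qed
  then show ?thesis
    unfolding filterlim_at_top eventually_sequentially
    by (meson order_trans strict_mono_angle strict_mono_less_eq)
qed

lemma exp_minus_angle_tendsto_0: "(\<lambda>n. exp (- angle n)) \<longlonglongrightarrow> 0"
  by (rule filterlim_compose[OF exp_at_bot])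
     (simp add: filterlim_uminus_at_bot angle_at_top)

lemma rho_angle_tendsto_1: "(\<lambda>n. rho (angle n)) \<longlonglongrightarrow> 1"
  using tendsto_add[OF tendsto_const[of 1] exp_minus_angle_tendsto_0] by (simp add: rho_def)

lemma eps_angle_tendsto_0: "(\<lambda>n. eps (angle n)) \<longlonglongrightarrow> 0"
  unfolding eps_eq by (rule tendsto_mult_left_zero[OF exp_minus_angle_tendsto_0])

lemma angle_step_tendsto_0: "(\<lambda>n. angle (Suc n) - angle n) \<longlonglongrightarrow> 0"
proof -
  define d where "d n = angle (Suc n) - angle n" for n
  have d: "0 \<le> d n" "d n \<le> pi" for n
    using angle_Suc(1)[of n] angle_step_less_ln_2[of n] ln_2_le_pi_half pi_gt_zero
    unfolding d_def by linarith+
  \<comment> \<open>The radii exceed 1, so the chord is at least as long as the chord of the same angle on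
    the unit circle.\<close>
  have "1 - cos (d n) \<le> (eps (angle n))\<^sup>2" for n
  proof -
    let ?a = "rho (angle n)" and ?b = "rho (angle (Suc n))"
    have "1 * 1 \<le> (2 * ?a) * ?b"
      using rho_gt_1[of "angle n"] rho_gt_1[of "angle (Suc n)"] by (intro mult_mono) auto
    then have "1 * (1 - cos (d n)) \<le> (2 * ?a * ?b) * (1 - cos (d n))"
      by (intro mult_right_mono) auto
    also have "\<dots> \<le> (eps (angle n))\<^sup>2"
      unfolding angle_Suc(2)[symmetric] norm_chord_sq by (simp add: d_def algebra_simps)
    finally show ?thesis by simp
  qed
  moreover have "(\<lambda>n. (eps (angle n))\<^sup>2) \<longlonglongrightarrow> 0"
    using tendsto_power[OF eps_angle_tendsto_0, of 2] by simp
  ultimately have "(\<lambda>n. 1 - cos (d n)) \<longlonglongrightarrow> 0"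
    by (intro tendsto_sandwich[of "\<lambda>_. 0" "\<lambda>n. 1 - cos (d n)" _ "\<lambda>n. (eps (angle n))\<^sup>2"])
       (simp_all add: always_eventually)
  from tendsto_diff[OF tendsto_const[of 1] this] have "(\<lambda>n. cos (d n)) \<longlonglongrightarrow> 1" by simp
  then have "(\<lambda>n. arccos (cos (d n))) \<longlonglongrightarrow> arccos 1"
    by (intro continuous_on_tendsto_compose[OF continuous_on_arccos']) auto
  then show ?thesis using d by (simp add: arccos_cos d_def)
qed

section \<open>Nearest points and cluster points of the spiral\<close>

lemma norm_spiral_step: "norm (spiral n - spiral (Suc n)) = eps (angle n)"
  using angle_Suc(2)[of n] by (simp add: spiral_def norm_minus_commute)

lemma eps_le_norm_spiral_diff:
  assumes "k < m"
  shows "eps (angle k) \<le> norm (spiral k - spiral m)"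
proof (cases "m = Suc k")
  case False
  with assms have "angle (Suc k) < angle m"
    using strict_mono_angle by (simp add: strict_mono_less)
  from eps_less_chord_beyond[OF angle_Suc this] show ?thesis
    unfolding spiral_def norm_minus_commute[of "curve (angle k)"] by (rule less_imp_le)
qed (simp add: norm_spiral_step)

lemma eps_less_norm_spiral_diff:
  assumes "k \<noteq> m" "k \<noteq> Suc m"
  shows "eps (angle m) < norm (spiral m - spiral k)"
proof (cases "k < m")
  case True
  then have "eps (angle m) < eps (angle k)"
    using strict_mono_angle by (intro eps_strict_antimono) (simp add: strict_mono_less)
  with eps_le_norm_spiral_diff[OF True] show ?thesis by (simp add: norm_minus_commute)
next
  case False
  with assms have "angle (Suc m) < angle k"
    using strict_mono_angle by (simp add: strict_mono_less)
  with eps_less_chord_beyond[OF angle_Suc] show ?thesis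
    by (simp add: spiral_def norm_minus_commute)
qed

lemma eps_less_norm_spiral_minus_unit:
  assumes "norm z = 1"
  shows "eps (angle m) < norm (spiral m - z)"
proof -
  have "exp (- angle m) \<le> norm (spiral m - z)"
    using norm_triangle_ineq2[of "spiral m" z] assms by (simp add: spiral_def norm_curve rho_def)
  with eps_less_half[of "angle m"] exp_gt_zero[of "- angle m"] show ?thesis by linarith
qed

lemma proj_spiral:
  assumes "Suc m \<in> I" "m \<notin> I"
  shows "proj (spiral ` I \<union> unit_circle) (spiral m) = {spiral (Suc m)}"
proof (rule proj_eq_singletonI)
  fix z assume z: "z \<in> spiral ` I \<union> unit_circle" "z \<noteq> spiral (Suc m)"
  then consider "norm z = 1" | k where "z = spiral k" "k \<noteq> m" "k \<noteq> Suc m"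
    using assms(2) by (auto simp: unit_circle_def)
  then show "norm (spiral m - spiral (Suc m)) < norm (spiral m - z)"
    by cases (simp_all add: norm_spiral_step eps_less_norm_spiral_diff
        eps_less_norm_spiral_minus_unit)
qed (use assms in auto)

lemma proj_self:
  assumes "y \<in> C"
  shows "proj C y = {y}"
  using assms by (intro proj_eq_singletonI) auto

lemma filterlim_double:
  fixes j :: nat
  shows "filterlim (\<lambda>n. 2 * n + j) sequentially sequentially"
  by (intro filterlim_subseq strict_monoI) simp

text \<open>
  The offset \<open>j\<close> treats both parities at once; each \<open>spiral m\<close> is at distance \<open>exp (- angle m)\<close>
  from its radial projection to the circle.
\<close>
lemma compact_spiral_Un: "compact (range (\<lambda>n. spiral (2 * n + j)) \<union> unit_circle)"
proof (rule compact_range_Un)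
  have "unit_circle = sphere 0 1" by (auto simp: unit_circle_def)
  then show "compact unit_circle" by (metis compact_sphere)
  let ?z = "\<lambda>n. vector [cos (angle (2 * n + j)), sin (angle (2 * n + j))] :: real ^ 2"
  show "?z n \<in> unit_circle" for n by (simp add: unit_circle_def norm_vector_2)
  have "dist (spiral m) (vector [cos (angle m), sin (angle m)]) = exp (- angle m)" for m
  proof -
    have "spiral m - vector [cos (angle m), sin (angle m)]
        = exp (- angle m) *\<^sub>R vector [cos (angle m), sin (angle m)]"
      by (simp add: spiral_def curve_def rho_def scaleR_add_left)
    then show ?thesis by (simp add: dist_norm norm_vector_2)
  qed
  then show "(\<lambda>n. dist (spiral (2 * n + j)) (?z n)) \<longlonglongrightarrow> 0"
    using filterlim_compose[OF exp_minus_angle_tendsto_0 filterlim_double] by simp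
qed

text \<open>
  The limit of radii places every cluster point on the circle.  Conversely, the angles of a fixed
  parity still have vanishing increments, so a subsequence converges modulo \<open>2 * pi\<close> to the
  argument of any given point of the circle.
\<close>
lemma cluster_points_spiral: "cluster_points (\<lambda>n. spiral (2 * n + j)) = unit_circle"
proof (intro equalityI subsetI)
  fix l assume "l \<in> cluster_points (\<lambda>n. spiral (2 * n + j))"
  then obtain r where r: "strict_mono r" "(\<lambda>n. spiral (2 * r n + j)) \<longlonglongrightarrow> l"
    by (auto simp: cluster_points_def o_def)
  have "(\<lambda>n. norm (spiral (2 * r n + j))) \<longlonglongrightarrow> 1"
    unfolding spiral_def norm_curve
    by (intro filterlim_compose[OF rho_angle_tendsto_1] filterlim_compose[OF filterlim_double]
        filterlim_subseq r)
  with tendsto_norm[OF r(2)] show "l \<in> unit_circle"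
    using LIMSEQ_unique by (auto simp: unit_circle_def)
next
  fix l assume "l \<in> unit_circle"
  then have "(l $ 1)\<^sup>2 + (l $ 2)\<^sup>2 = 1"
    by (simp add: unit_circle_def norm_eq_sqrt_inner inner_vec_def sum_2 power2_eq_square)
  then obtain t0 where "l $ 1 = cos t0" "l $ 2 = sin t0" "0 \<le> t0"
    using sincos_total_2pi by metis
  \<comment> \<open>The representative of the argument of \<open>l\<close> must lie above the first angle of the
    sequence, which depends on \<open>j\<close>.\<close>
  obtain i :: nat where i: "angle j < t0 + 2 * pi * real i"
  proof -
    obtain i :: nat where "angle j < real i * (2 * pi)"
      using reals_Archimedean3[of "2 * pi"] pi_gt_zero by auto
    with \<open>0 \<le> t0\<close> show thesis by (intro that[of i]) (simp add: algebra_simps)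
  qed
  define t where "t = t0 + 2 * pi * real i"
  have shift: "sin (u + 2 * pi * real k) = sin u" "cos (u + 2 * pi * real k) = cos u" for u k
    using sin_cos_eq_iff[of "u + 2 * pi * real k" u]
    by (metis Ints_of_nat of_int_of_nat_eq)+
  have l: "l = vector [cos t, sin t]"
    using \<open>l $ 1 = cos t0\<close> \<open>l $ 2 = sin t0\<close> by (simp add: vec_eq_iff forall_2 t_def shift)
  define s where "s n = angle (2 * n + j)" for n
  have step: "s (Suc n) - s n = (angle (Suc (2 * n + j)) - angle (2 * n + j))
      + (angle (Suc (Suc (2 * n + j))) - angle (Suc (2 * n + j)))" for n
    by (simp add: s_def)
  obtain r where r: "strict_mono r" "(\<lambda>k. s (r k) - (t + 2 * pi * real k)) \<longlonglongrightarrow> 0"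
  proof (rule vanishing_steps_imp_subsequence_mod)
    show "filterlim s at_top sequentially"
      unfolding s_def by (rule filterlim_compose[OF angle_at_top filterlim_double])
    have "(\<lambda>n. angle (Suc (Suc n)) - angle (Suc n)) \<longlonglongrightarrow> 0"
      by (rule LIMSEQ_Suc[OF angle_step_tendsto_0])
    then show "(\<lambda>n. s (Suc n) - s n) \<longlonglongrightarrow> 0"
      unfolding step
      by (intro tendsto_add_zero filterlim_compose[OF _ filterlim_double] angle_step_tendsto_0)
    show "s (Suc n) - s n < 2 * pi" for n
      unfolding step
      using angle_step_less_ln_2[of "2 * n + j"] angle_step_less_ln_2[of "Suc (2 * n + j)"]
        ln_2_le_pi_half pi_gt_zero by linarith
    show "s 0 < t" using i by (simp add: s_def t_def)
  qed simp_all
  define e where "e k = s (r k) - (t + 2 * pi * real k)" for k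
  have e: "e \<longlonglongrightarrow> 0" using r(2) unfolding e_def .
  have s: "s (r k) = (t + e k) + 2 * pi * real k" for k by (simp add: e_def)
  have "spiral (2 * r k + j) = rho (s (r k)) *\<^sub>R vector [cos (t + e k), sin (t + e k)]" for k
  proof -
    have "cos (s (r k)) = cos (t + e k)" "sin (s (r k)) = sin (t + e k)"
      by (simp_all only: s shift)
    then show ?thesis by (simp add: spiral_def curve_def flip: s_def)
  qed
  moreover have "(\<lambda>k. rho (s (r k))) \<longlonglongrightarrow> 1"
    unfolding s_def
    by (intro filterlim_compose[OF rho_angle_tendsto_1] filterlim_compose[OF filterlim_double]
        filterlim_subseq r)
  moreover have "(\<lambda>k. vector [cos (t + e k), sin (t + e k)] :: real ^ 2) \<longlonglongrightarrow> vector [cos t, sin t]"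
  proof (rule vec_tendstoI)
    have "(\<lambda>k. t + e k) \<longlonglongrightarrow> t" using tendsto_add[OF tendsto_const e] by simp
    then show "(\<lambda>k. (vector [cos (t + e k), sin (t + e k)] :: real ^ 2) $ i)
        \<longlonglongrightarrow> vector [cos t, sin t] $ i" for i
      using exhaust_2[of i] by (auto intro: tendsto_cos tendsto_sin)
  qed
  ultimately have "(\<lambda>k. spiral (2 * r k + j)) \<longlonglongrightarrow> l"
    unfolding l using tendsto_scaleR by fastforce
  with r(1) show "l \<in> cluster_points (\<lambda>n. spiral (2 * n + j))"
    by (auto simp: cluster_points_def o_def)
qed

section \<open>Alternating projections\<close>

lemma even_set_eq: "even_set = spiral ` {n. even n} \<union> unit_circle"
  by (auto simp: even_set_def elim!: evenE)

lemma odd_set_eq: "odd_set = spiral ` {n. odd n} \<union> unit_circle"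
  by (auto simp: odd_set_def elim!: oddE)

lemma proj_even_set:
  "proj even_set (preceding (spiral 0) (\<lambda>n. spiral (2 * n + 1)) n) = {spiral (2 * n)}"
proof (cases n)
  case 0
  have "spiral 0 \<in> even_set" by (auto simp: even_set_eq)
  with 0 show ?thesis by (simp add: preceding_def proj_self)
next
  case (Suc m)
  then show ?thesis
    using proj_spiral[of "2 * m + 1" "{n. even n}"] by (simp add: preceding_def even_set_eq)
qed

lemma proj_odd_set: "proj odd_set (spiral (2 * n)) = {spiral (2 * n + 1)}"
  using proj_spiral[of "2 * n" "{n. odd n}"] by (simp add: odd_set_eq)

lemma alternating_projections_iff:
  "alternating_projections even_set odd_set (spiral 0) a b
    \<longleftrightarrow> a = (\<lambda>n. spiral (2 * n)) \<and> b = (\<lambda>n. spiral (2 * n + 1))"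
proof
  assume *: "alternating_projections even_set odd_set (spiral 0) a b"
  have "a n = spiral (2 * n) \<and> b n = spiral (2 * n + 1)" for n
  proof (induction n)
    case 0
    have "preceding (spiral 0) b 0 = preceding (spiral 0) (\<lambda>n. spiral (2 * n + 1)) 0"
      by (simp add: preceding_def)
    with * proj_even_set[of 0] proj_odd_set[of 0] show ?case
      unfolding alternating_projections_def by (metis singletonD)
  next
    case (Suc n)
    then have "preceding (spiral 0) b (Suc n)
        = preceding (spiral 0) (\<lambda>n. spiral (2 * n + 1)) (Suc n)"
      by (simp add: preceding_def)
    with * proj_even_set[of "Suc n"] proj_odd_set[of "Suc n"] show ?case
      unfolding alternating_projections_def by (metis singletonD)
  qed
  then show "a = (\<lambda>n. spiral (2 * n)) \<and> b = (\<lambda>n. spiral (2 * n + 1))" by auto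
qed (simp add: alternating_projections_def proj_even_set[simplified] proj_odd_set[simplified])

theorem corollary3p2:
  shows "even_set \<noteq> {} \<and> compact even_set \<and> odd_set \<noteq> {} \<and> compact odd_set \<and>
    (\<exists>a b. alternating_projections even_set odd_set (spiral 0) a b) \<and>
    (\<forall>a b. alternating_projections even_set odd_set (spiral 0) a b \<longrightarrow>
       (\<forall>n. proj even_set (preceding (spiral 0) b n) = {a n} \<and> {a n} = {spiral (2 * n)} \<and>
            proj odd_set (a n) = {b n} \<and> {b n} = {spiral (2 * n + 1)}) \<and>
       (\<lambda>n. a n - preceding (spiral 0) b n) \<longlonglongrightarrow> 0 \<and>
       (\<lambda>n. b n - a n) \<longlonglongrightarrow> 0 \<and>
       unit_circle = cluster_points a \<and>
       unit_circle = cluster_points b)"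
proof -
  let ?a = "\<lambda>n. spiral (2 * n)" and ?b = "\<lambda>n. spiral (2 * n + 1)"
  have sets: "even_set = range ?a \<union> unit_circle" "odd_set = range ?b \<union> unit_circle"
    by (auto simp: even_set_def odd_set_def)
  have compact: "compact even_set" "compact odd_set"
    unfolding sets using compact_spiral_Un[of 0] compact_spiral_Un[of 1] by simp_all
  have "(\<lambda>m. spiral (Suc m) - spiral m) \<longlonglongrightarrow> 0"
    by (rule tendsto_norm_zero_cancel)
       (simp add: norm_minus_commute[of "spiral (Suc _)"] norm_spiral_step eps_angle_tendsto_0)
  then have step: "(\<lambda>n. spiral (Suc (2 * n + j)) - spiral (2 * n + j)) \<longlonglongrightarrow> 0" for j
    by (rule filterlim_compose[OF _ filterlim_double])
  have lim_b: "(\<lambda>n. ?b n - ?a n) \<longlonglongrightarrow> 0"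
    using step[of 0] by simp
  have "(\<lambda>n. ?a (Suc n) - preceding (spiral 0) ?b (Suc n)) \<longlonglongrightarrow> 0"
    using step[of 1] by (simp add: preceding_def)
  then have lim_a: "(\<lambda>n. ?a n - preceding (spiral 0) ?b n) \<longlonglongrightarrow> 0"
    by (rule LIMSEQ_imp_Suc)
  have cluster: "cluster_points ?a = unit_circle" "cluster_points ?b = unit_circle"
    using cluster_points_spiral[of 0] cluster_points_spiral[of 1] by simp_all
  show ?thesis
    unfolding alternating_projections_iff
    using compact lim_a lim_b cluster proj_even_set proj_odd_set
    by (auto simp: sets(1)[symmetric] sets(2)[symmetric]) (auto simp: sets)
qed

end
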